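(* Let $\mathcal{S}$ be a structural abstract logic in a propositional language $\mathcal{L}$ that is determined by a nonempty set $\mathcal{M}=\{\mathbf{M}_j\}_{j\in J}$ of $\mathcal{L}$-matrices (i.e. $\vdash_{\mathcal{S}}\,=\,\vdash_{\mathcal{M}}$). The logic $\mathcal{S}$ is couniform if, and only if, for any collection $\{X_i\}_{i\in I}$ of sets of $\mathcal{L}$-formulae with $\mathcal{V}(X_i)\cap\mathcal{V}(X_{i'})=\varnothing$ whenever $i\neq i'$, and with $\mathcal{V}(\bigcup_{i\in I}X_i)\neq\mathcal{V}_{\mathcal{L}}$, the following condition is satisfied: if for every $i\in I$ there are $j\in J$ and $Z_j\in\mathfrak{S}(\mathbf{M}_j)$ with $X_i\subseteq Z_j\subsetneq\mathbf{Fm}_{\mathcal{L}}$, then there are $k\in J$ and $Z_k\in\mathfrak{S}(\mathbf{M}_k)$ with $\bigcup_{i\in I}X_i\subseteq Z_k\subsetneq\mathbf{Fm}_{\mathcal{L}}$.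
   Context: $\mathcal{L}$ is an abstract propositional language, given by a set $\mathcal{V}_{\mathcal{L}}$ of variables, a set of constants and a set of finitary connectives. $\mathbf{Fm}_{\mathcal{L}}$ is the set of all $\mathcal{L}$-formulae; $\mathcal{V}(\alpha)$ is the set of variables occurring in $\alpha$, and $\mathcal{V}(X)=\bigcup_{\alpha\in X}\mathcal{V}(\alpha)$ for $X\subseteq\mathbf{Fm}_{\mathcal{L}}$. A structural abstract logic $\mathcal{S}$ is given by a (not necessarily finitary) consequence relation $\vdash_{\mathcal{S}}$ on $\mathbf{Fm}_{\mathcal{L}}$ (reflexive, monotone, transitive/closed under cut) closed under substitutions, equivalently by its consequence operator $\mathbf{Cn}_{\mathcal{S}}(X)=\{\alpha : X\vdash_{\mathcal{S}}\alpha\}$. A set $X$ is consistent if $\mathbf{Cn}_{\mathcal{S}}(X)\neq\mathbf{Fm}_{\mathcal{L}}$. $\mathcal{S}$ is couniform if for any collection $\{X_i\}_{i\in I}$ of formula sets with $\mathcal{V}(X_i)\cap\mathcal{V}(X_{i'})=\varnothing$ for $i\neq i'$ and $\mathcal{V}(\bigcup_{i\in I}X_i)\neq\mathcal{V}_{\mathcal{L}}$: if $\bigcup_{i\in I}X_i$ is inconsistent, then at least one $X_i$ is inconsistent. An $\mathcal{L}$-matrix is a pair $\mathbf{M}=\langle\mathbf{A},D\rangle$ with $\mathbf{A}$ an algebra of the signature of $\mathcal{L}$ and $D\subseteq|\mathbf{A}|$. $X\models_{\mathbf{M}}\alpha$ means: for every valuation $v$ in $\mathbf{A}$ (homomorphism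 from the formula algebra to $\mathbf{A}$), if $v[X]\subseteq D$ then $v[\alpha]\in D$. For a nonempty set $\mathcal{M}=\{\mathbf{M}_j\}_{j\in J}$, $X\vdash_{\mathcal{M}}\alpha$ iff $X\models_{\mathbf{M}_j}\alpha$ for each $j\in J$. $\mathfrak{S}(\mathbf{M})$, for $\mathbf{M}=\langle\mathbf{A},D\rangle$, is the set of all $X\subseteq\mathbf{Fm}_{\mathcal{L}}$ such that $X=\{\alpha\in\mathbf{Fm}_{\mathcal{L}} : v[\alpha]\in D\}$ for some valuation $v$ in $\mathbf{A}$. *)

theory Defs
  imports Main
begin

record ('v, 'c, 'f) language =
  lvars :: "'v set"
  lconsts :: "'c set"
  lconns :: "'f set"
  arity :: "'f \<Rightarrow> nat"

text \<open>The datatype contains ill-formed terms as well (foreign symbols, wrong number of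
  arguments); the formulae of a language \<open>L\<close> are the elements of \<open>Fm L\<close> below.
  The set function \<open>fvars\<close> generated by the datatype package yields the variables
  occurring in a term.\<close>

datatype (fvars: 'v, dead 'c, dead 'f) form =
    Var 'v
  | Const 'c
  | Conn 'f "('v, 'c, 'f) form list"

inductive_set Fm :: "('v, 'c, 'f) language \<Rightarrow> ('v, 'c, 'f) form set"
  for L :: "('v, 'c, 'f) language" where
  Var: "p \<in> lvars L \<Longrightarrow> Var p \<in> Fm L"
| Const: "c \<in> lconsts L \<Longrightarrow> Const c \<in> Fm L"
| Conn: "\<lbrakk>f \<in> lconns L; length ts = arity L f; \<forall>t \<in> set ts. t \<in> Fm L\<rbrakk> \<Longrightarrow> Conn f ts \<in> Fm L"

definition Vars :: "('v, 'c, 'f) form set \<Rightarrow> 'v set" where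
  "Vars X = (\<Union>\<alpha>\<in>X. fvars \<alpha>)"

primrec subst :: "('v \<Rightarrow> ('v, 'c, 'f) form) \<Rightarrow> ('v, 'c, 'f) form \<Rightarrow> ('v, 'c, 'f) form" where
  "subst \<sigma> (Var p) = \<sigma> p"
| "subst \<sigma> (Const c) = Const c"
| "subst \<sigma> (Conn f ts) = Conn f (map (subst \<sigma>) ts)"

text \<open>A consequence relation on \<open>Fm L\<close> is represented by a predicate that holds only for
  \<open>X \<subseteq> Fm L\<close> and \<open>\<alpha> \<in> Fm L\<close> (first conjunct).\<close>

definition structural_logic ::
    "('v, 'c, 'f) language \<Rightarrow> (('v, 'c, 'f) form set \<Rightarrow> ('v, 'c, 'f) form \<Rightarrow> bool) \<Rightarrow> bool" where
  "structural_logic L S \<longleftrightarrow>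
     (\<forall>X \<alpha>. S X \<alpha> \<longrightarrow> X \<subseteq> Fm L \<and> \<alpha> \<in> Fm L) \<and>
     (\<forall>X \<alpha>. X \<subseteq> Fm L \<longrightarrow> \<alpha> \<in> X \<longrightarrow> S X \<alpha>) \<and>
     (\<forall>X Y \<alpha>. X \<subseteq> Y \<longrightarrow> Y \<subseteq> Fm L \<longrightarrow> S X \<alpha> \<longrightarrow> S Y \<alpha>) \<and>
     (\<forall>X Y \<alpha>. X \<subseteq> Fm L \<longrightarrow> Y \<subseteq> Fm L \<longrightarrow> (\<forall>\<beta>\<in>Y. S X \<beta>) \<longrightarrow> S (X \<union> Y) \<alpha> \<longrightarrow> S X \<alpha>) \<and>
     (\<forall>\<sigma> X \<alpha>. (\<forall>p \<in> lvars L. \<sigma> p \<in> Fm L) \<longrightarrow> S X \<alpha> \<longrightarrow> S (subst \<sigma> ` X) (subst \<sigma> \<alpha>))"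

definition Cn ::
    "(('v, 'c, 'f) form set \<Rightarrow> ('v, 'c, 'f) form \<Rightarrow> bool) \<Rightarrow>
     ('v, 'c, 'f) form set \<Rightarrow> ('v, 'c, 'f) form set" where
  "Cn S X = {\<alpha>. S X \<alpha>}"

definition consistent ::
    "('v, 'c, 'f) language \<Rightarrow> (('v, 'c, 'f) form set \<Rightarrow> ('v, 'c, 'f) form \<Rightarrow> bool) \<Rightarrow>
     ('v, 'c, 'f) form set \<Rightarrow> bool" where
  "consistent L S X \<longleftrightarrow> Cn S X \<noteq> Fm L"

definition separated_family ::
    "('v, 'c, 'f) language \<Rightarrow> 'i set \<Rightarrow> ('i \<Rightarrow> ('v, 'c, 'f) form set) \<Rightarrow> bool" where
  "separated_family L I X \<longleftrightarrow>
     (\<forall>i\<in>I. X i \<subseteq> Fm L) \<and>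
     (\<forall>i\<in>I. \<forall>i'\<in>I. i \<noteq> i' \<longrightarrow> Vars (X i) \<inter> Vars (X i') = {}) \<and>
     Vars (\<Union>i\<in>I. X i) \<noteq> lvars L"

text \<open>HOL cannot quantify over index types inside a definition, so the index sets range
  over sets of sets of formulae. This is no restriction: reindexing a family by its own
  members preserves the members, their union and separatedness, as the two lemmas
  following the definition make precise.\<close>

definition couniform ::
    "('v, 'c, 'f) language \<Rightarrow> (('v, 'c, 'f) form set \<Rightarrow> ('v, 'c, 'f) form \<Rightarrow> bool) \<Rightarrow> bool" where
  "couniform L S \<longleftrightarrow>
     (\<forall>(I :: ('v, 'c, 'f) form set set) X. separated_family L I X \<longrightarrow>
        \<not> consistent L S (\<Union>i\<in>I. X i) \<longrightarrow> (\<exists>i\<in>I. \<not> consistent L S (X i)))"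

lemma separated_family_reindex:
  fixes P :: "('v, 'c, 'f) form set set \<Rightarrow> bool" and I :: "'i set"
  assumes "\<And>(K :: ('v, 'c, 'f) form set set) Y. separated_family L K Y \<Longrightarrow> P (Y ` K)"
    and "separated_family L I X"
  shows "P (X ` I)"
proof -
  have "separated_family L (X ` I) (\<lambda>Y. Y)"
    unfolding separated_family_def
  proof (intro conjI)
    show "\<forall>Y\<in>X ` I. Y \<subseteq> Fm L"
      using assms(2) unfolding separated_family_def by blast
    show "\<forall>Y\<in>X ` I. \<forall>Y'\<in>X ` I. Y \<noteq> Y' \<longrightarrow> Vars Y \<inter> Vars Y' = {}"
    proof (intro ballI impI)
      fix Y Y' assume "Y \<in> X ` I" "Y' \<in> X ` I" and ne: "Y \<noteq> Y'"
      then obtain i i' where i: "i \<in> I" "Y = X i" "i' \<in> I" "Y' = X i'"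
        by (elim imageE)
      with ne have "i \<noteq> i'" by metis
      with i show "Vars Y \<inter> Vars Y' = {}"
        using assms(2) unfolding separated_family_def by metis
    qed
    show "Vars (\<Union>Y\<in>X ` I. Y) \<noteq> lvars L"
      using assms(2) unfolding separated_family_def by simp
  qed
  from assms(1)[OF this] show ?thesis by simp
qed

lemma couniform_arbitrary_index:
  fixes I :: "'i set"
  assumes "couniform L S" and "separated_family L I X"
    and "\<not> consistent L S (\<Union>i\<in>I. X i)"
  shows "\<exists>i\<in>I. \<not> consistent L S (X i)"
proof -
  let ?P = "\<lambda>F. \<not> consistent L S (\<Union>F) \<longrightarrow> (\<exists>Y\<in>F. \<not> consistent L S Y)"
  have "?P (Y ` K)" if "separated_family L K Y"
    for K :: "('a, 'b, 'c) form set set" and Y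
    using assms(1) that unfolding couniform_def by (simp add: bex_simps)
  from separated_family_reindex[where P = ?P, OF this assms(2)]
  show ?thesis using assms(3) by simp
qed

text \<open>The algebra component of a matrix is its carrier together with the interpretation of
  constants and connectives; operations are constrained only on argument lists of the right
  length over the carrier. As usual, algebras have nonempty carriers.\<close>

record ('c, 'f, 'a) matrix =
  carrier :: "'a set"
  const_op :: "'c \<Rightarrow> 'a"
  conn_op :: "'f \<Rightarrow> 'a list \<Rightarrow> 'a"
  designated :: "'a set"

definition is_matrix :: "('v, 'c, 'f) language \<Rightarrow> ('c, 'f, 'a) matrix \<Rightarrow> bool" where
  "is_matrix L M \<longleftrightarrow>
     carrier M \<noteq> {} \<and>
     (\<forall>c \<in> lconsts L. const_op M c \<in> carrier M) \<and>
     (\<forall>f \<in> lconns L. \<forall>xs. length xs = arity L f \<longrightarrow> set xs \<subseteq> carrier M \<longrightarrow>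
        conn_op M f xs \<in> carrier M) \<and>
     designated M \<subseteq> carrier M"

definition valuation ::
    "('v, 'c, 'f) language \<Rightarrow> ('c, 'f, 'a) matrix \<Rightarrow> (('v, 'c, 'f) form \<Rightarrow> 'a) \<Rightarrow> bool" where
  "valuation L M v \<longleftrightarrow>
     (\<forall>\<alpha> \<in> Fm L. v \<alpha> \<in> carrier M) \<and>
     (\<forall>c \<in> lconsts L. v (Const c) = const_op M c) \<and>
     (\<forall>f \<in> lconns L. \<forall>ts. length ts = arity L f \<longrightarrow> set ts \<subseteq> Fm L \<longrightarrow>
        v (Conn f ts) = conn_op M f (map v ts))"

definition matrix_models ::
    "('v, 'c, 'f) language \<Rightarrow> ('c, 'f, 'a) matrix \<Rightarrow>
     ('v, 'c, 'f) form set \<Rightarrow> ('v, 'c, 'f) form \<Rightarrow> bool" where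
  "matrix_models L M X \<alpha> \<longleftrightarrow>
     (\<forall>v. valuation L M v \<longrightarrow> v ` X \<subseteq> designated M \<longrightarrow> v \<alpha> \<in> designated M)"

definition matrices_entail ::
    "('v, 'c, 'f) language \<Rightarrow> 'j set \<Rightarrow> ('j \<Rightarrow> ('c, 'f, 'a) matrix) \<Rightarrow>
     ('v, 'c, 'f) form set \<Rightarrow> ('v, 'c, 'f) form \<Rightarrow> bool" where
  "matrices_entail L J M X \<alpha> \<longleftrightarrow>
     X \<subseteq> Fm L \<and> \<alpha> \<in> Fm L \<and> (\<forall>j\<in>J. matrix_models L (M j) X \<alpha>)"

definition matrix_theories ::
    "('v, 'c, 'f) language \<Rightarrow> ('c, 'f, 'a) matrix \<Rightarrow> ('v, 'c, 'f) form set set" where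
  "matrix_theories L M =
     {X. \<exists>v. valuation L M v \<and> X = {\<alpha> \<in> Fm L. v \<alpha> \<in> designated M}}"

end

theory Submission
  imports Defs
begin

text \<open>For a logic determined by matrices, consistency is a semantic notion: a set of formulae
  is consistent exactly when some valuation in some matrix of the family designates all of it but
  not every formula, that is, when it lies in a proper member of some
  \<open>matrix_theories L (M j)\<close>. This is \<open>consistent_matrices_entail_iff\<close>.
  Couniformity, read contrapositively, says that a separated family of consistent sets has a
  consistent union; replacing both occurrences of consistency by the semantic criterion gives the
  stated condition.\<close>

lemma consistent_matrices_entail_iff:
  assumes "X \<subseteq> Fm L"
  shows "consistent L (matrices_entail L J M) X \<longleftrightarrow>
    (\<exists>j\<in>J. \<exists>Z \<in> matrix_theories L (M j). X \<subseteq> Z \<and> Z \<subset> Fm L)"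
    (is "?C \<longleftrightarrow> ?Z")
proof
  assume ?C
  \<comment> \<open>\<open>matrices_entail\<close> only ever yields members of \<open>Fm L\<close>,
    so a closure different from \<open>Fm L\<close> must miss some formula.\<close>
  then obtain \<alpha> where "\<alpha> \<in> Fm L" "\<not> matrices_entail L J M X \<alpha>"
    unfolding consistent_def Cn_def matrices_entail_def by blast
  then obtain j v where j: "j \<in> J" and v: "valuation L (M j) v"
      "v ` X \<subseteq> designated (M j)" "v \<alpha> \<notin> designated (M j)"
    using assms unfolding matrices_entail_def matrix_models_def by blast
  \<comment> \<open>The theory of the refuting valuation is the required set: it includes
    \<open>X\<close>, and it is proper because it omits \<open>\<alpha>\<close>.\<close>
  let ?T = "{\<beta> \<in> Fm L. v \<beta> \<in> designated (M j)}"
  have "?T \<in> matrix_theories L (M j)"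
    using v(1) unfolding matrix_theories_def by blast
  moreover have "X \<subseteq> ?T" "?T \<subset> Fm L"
    using assms v \<open>\<alpha> \<in> Fm L\<close> by auto
  ultimately show ?Z using j by blast
next
  assume ?Z
  then obtain j v where j: "j \<in> J" and v: "valuation L (M j) v"
    and X: "X \<subseteq> {\<beta> \<in> Fm L. v \<beta> \<in> designated (M j)}"
    and proper: "{\<beta> \<in> Fm L. v \<beta> \<in> designated (M j)} \<subset> Fm L"
    unfolding matrix_theories_def by blast
  \<comment> \<open>A formula outside the theory is refuted by the very valuation that designates
    \<open>X\<close>, so \<open>X\<close> does not entail it.\<close>
  from proper obtain \<alpha> where \<alpha>: "\<alpha> \<in> Fm L" "v \<alpha> \<notin> designated (M j)" by blast
  have "v ` X \<subseteq> designated (M j)" using X by blast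
  with j v \<alpha> have "\<not> matrices_entail L J M X \<alpha>"
    unfolding matrices_entail_def matrix_models_def by blast
  with \<alpha>(1) show ?C unfolding consistent_def Cn_def by blast
qed

theorem proposition3p1:
  fixes L :: "('v, 'c, 'f) language"
    and S :: "('v, 'c, 'f) form set \<Rightarrow> ('v, 'c, 'f) form \<Rightarrow> bool"
    and J :: "'j set"
    and M :: "'j \<Rightarrow> ('c, 'f, 'a) matrix"
  assumes "structural_logic L S"
    and "J \<noteq> {}"
    and "\<forall>j\<in>J. is_matrix L (M j)"
    and "S = matrices_entail L J M"
  shows "couniform L S \<longleftrightarrow>
    (\<forall>(I :: ('v, 'c, 'f) form set set) X. separated_family L I X \<longrightarrow>
       (\<forall>i\<in>I. \<exists>j\<in>J. \<exists>Z \<in> matrix_theories L (M j). X i \<subseteq> Z \<and> Z \<subset> Fm L) \<longrightarrow>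
       (\<exists>k\<in>J. \<exists>Z \<in> matrix_theories L (M k). (\<Union>i\<in>I. X i) \<subseteq> Z \<and> Z \<subset> Fm L))"
proof -
  \<comment> \<open>Separatedness supplies the inclusion in \<open>Fm L\<close> that the criterion
    requires, here for the members and next for their union.\<close>
  have "consistent L S (X i)
      \<longleftrightarrow> (\<exists>j\<in>J. \<exists>Z \<in> matrix_theories L (M j). X i \<subseteq> Z \<and> Z \<subset> Fm L)"
    if "separated_family L I X" "i \<in> I"
    for I :: "('v, 'c, 'f) form set set" and X i
    unfolding assms(4) using that
    by (intro consistent_matrices_entail_iff) (auto simp: separated_family_def)
  moreover have "consistent L S (\<Union>i\<in>I. X i)
      \<longleftrightarrow> (\<exists>k\<in>J. \<exists>Z \<in> matrix_theories L (M k). (\<Union>i\<in>I. X i) \<subseteq> Z \<and> Z \<subset> Fm L)"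
    if "separated_family L I X"
    for I :: "('v, 'c, 'f) form set set" and X
    unfolding assms(4) using that
    by (intro consistent_matrices_entail_iff) (auto simp: separated_family_def)
  \<comment> \<open>Contraposition puts couniformity in terms of consistency, so that both
    equivalences can be substituted under the same quantifiers.\<close>
  moreover have "couniform L S \<longleftrightarrow>
    (\<forall>(I :: ('v, 'c, 'f) form set set) X. separated_family L I X \<longrightarrow>
       (\<forall>i\<in>I. consistent L S (X i)) \<longrightarrow> consistent L S (\<Union>i\<in>I. X i))"
    unfolding couniform_def by blast
  ultimately show ?thesis by (simp cong: imp_cong ball_cong)
qed

end
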